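(* Let $h:\mathbb N\to\mathbb N$ be a strictly increasing function and $\alpha,\beta$ ordinals below $\varepsilon_0$ (with $\beta+1+\alpha<\varepsilon_0$). (i) If $h\in\mathscr F_\beta$, then $\mathbf F_{h,\alpha}\subseteq\mathbf F_{\beta+1+\alpha}$. (ii) If $h(x)\le F_\beta(x)$ for all $x\in\mathbb N$, then $\mathbf F_{h,\alpha}\subseteq\mathbf F_{\beta+\alpha}$.
   Context: Ordinals are below $\varepsilon_0$ in Cantor normal form; ordinal addition is the usual (non-commutative) one. Each limit ordinal $\lambda$ has the fundamental sequence $(\gamma+\omega^{\beta+1})(x)=\gamma+\omega^\beta\cdot(x+1)$, $(\gamma+\omega^{\lambda'})(x)=\gamma+\omega^{\lambda'(x)}$ for $\lambda'$ limit. Fast-growing functions: $F_0(x)=x+1$, $F_{\alpha+1}(x)=F_\alpha^{x+1}(x)$, $F_\lambda(x)=F_{\lambda(x)}(x)$. Relativized fast-growing functions for $h:\mathbb N\to\mathbb N$: $F_{h,0}(x)=h(x)$, $F_{h,\alpha+1}(x)=F_{h,\alpha}^{x+1}(x)$, $F_{h,\lambda}(x)=F_{h,\lambda(x)}(x)$. Extended Grzegorczyk class $\mathscr F_\alpha$: smallest class of functions $\mathbb N^k\to\mathbb N$ containing the zero function, addition, projections and $F_\alpha$, closed under composition and limited primitive recursion (primitive recursion whose result is bounded by $g(\max$ of arguments$)$ for some $g$ in the class). $\mathscr F_{<\alpha}=\bigcup_{\beta<\alpha}\mathscr F_\beta$. $\mathrm{DTime}(t(n))$: languages decided by a deterministic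 Turing machine in at most $t(n)$ steps on inputs of length $n$. Complexity classes: $\mathbf F_\alpha=\bigcup_{p\in\mathscr F_{<\alpha}}\mathrm{DTime}(F_\alpha(p(n)))$ and $\mathbf F_{h,\alpha}=\bigcup_{p\in\mathscr F_{<\alpha}}\mathrm{DTime}(F_{h,\alpha}(p(n)))$, with $p$ unary. *)

theory Defs
  imports Main
begin

section \<open>Ordinals below \<open>\<epsilon>\<^sub>0\<close> in Cantor normal form\<close>

text \<open>
  \<open>OAdd a b\<close> denotes \<open>\<omega>\<^sup>a + b\<close>.  On raw terms the order below is the lexicographic one, which
  agrees with the ordinal order on the terms in Cantor normal form.
\<close>

datatype oterm = OZero | OAdd oterm oterm

instantiation oterm :: linorder
begin

fun less_oterm :: "oterm \<Rightarrow> oterm \<Rightarrow> bool" where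
  "less_oterm s OZero \<longleftrightarrow> False"
| "less_oterm OZero (OAdd c d) \<longleftrightarrow> True"
| "less_oterm (OAdd a b) (OAdd c d) \<longleftrightarrow> less_oterm a c \<or> a = c \<and> less_oterm b d"

definition less_eq_oterm :: "oterm \<Rightarrow> oterm \<Rightarrow> bool" where
  "less_eq_oterm s t \<longleftrightarrow> s < t \<or> s = t"

instance
proof
  have irr: "\<not> s < s" for s :: oterm
    by (induction s) auto
  have tr: "s < t \<Longrightarrow> t < u \<Longrightarrow> s < u" for s t u :: oterm
  proof (induction t arbitrary: s u)
    case (OAdd t1 t2)
    show ?case
    proof (cases s; cases u)
      fix a b c d assume "s = OAdd a b" "u = OAdd c d"
      then show ?thesis using OAdd.prems OAdd.IH(1)[of a c] OAdd.IH(2)[of b d] by auto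
    qed (use OAdd.prems in auto)
  qed auto
  have tot: "s < t \<or> s = t \<or> t < s" for s t :: oterm
  proof (induction s arbitrary: t)
    case OZero
    then show ?case by (cases t) auto
  next
    case (OAdd s1 s2)
    then show ?case by (cases t) auto
  qed
  fix s t u :: oterm
  show "(s < t) = (s \<le> t \<and> \<not> t \<le> s)"
    using irr tr by (auto simp: less_eq_oterm_def)
  show "s \<le> s" by (simp add: less_eq_oterm_def)
  show "s \<le> t \<Longrightarrow> t \<le> u \<Longrightarrow> s \<le> u" using tr by (auto simp: less_eq_oterm_def)
  show "s \<le> t \<Longrightarrow> t \<le> s \<Longrightarrow> s = t" using irr tr by (auto simp: less_eq_oterm_def)
  show "s \<le> t \<or> t \<le> s" using tot by (auto simp: less_eq_oterm_def)
qed

end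

text \<open>Normal form: the exponents are themselves normal and weakly decreasing.\<close>

fun cnf :: "oterm \<Rightarrow> bool" where
  "cnf OZero \<longleftrightarrow> True"
| "cnf (OAdd a OZero) \<longleftrightarrow> cnf a"
| "cnf (OAdd a (OAdd b c)) \<longleftrightarrow> cnf a \<and> cnf (OAdd b c) \<and> b \<le> a"

fun oplus :: "oterm \<Rightarrow> oterm \<Rightarrow> oterm" where
  "oplus OZero t = t"
| "oplus s OZero = s"
| "oplus (OAdd a b) (OAdd c d) = (if a < c then OAdd c d else OAdd a (oplus b (OAdd c d)))"

text \<open>\<open>omult a n\<close> is \<open>\<omega>\<^sup>a \<cdot> n\<close>.\<close>

primrec omult :: "oterm \<Rightarrow> nat \<Rightarrow> oterm" where
  "omult a 0 = OZero"
| "omult a (Suc n) = OAdd a (omult a n)"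

fun osucc :: "oterm \<Rightarrow> bool" where
  "osucc OZero \<longleftrightarrow> False"
| "osucc (OAdd a b) \<longleftrightarrow> (if b = OZero then a = OZero else osucc b)"

fun opred :: "oterm \<Rightarrow> oterm" where
  "opred OZero = OZero"
| "opred (OAdd a b) = (if b = OZero then OZero else OAdd a (opred b))"

text \<open>
  The fundamental sequence of a limit rewrites only the last summand of the normal form:
  \<open>\<omega>\<^bsup>a+1\<^esup>\<close> becomes \<open>\<omega>\<^sup>a \<cdot> (x + 1)\<close>, and \<open>\<omega>\<^sup>a\<close> with \<open>a\<close> a limit becomes \<open>\<omega>\<^bsup>a(x)\<^esup>\<close>.
  The values on terms that are not limits are never used.
\<close>

fun ofund :: "oterm \<Rightarrow> nat \<Rightarrow> oterm" where
  "ofund OZero x = OZero"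
| "ofund (OAdd a b) x =
    (if b \<noteq> OZero then OAdd a (ofund b x)
     else if a = OZero then OZero
     else if osucc a then omult (opred a) (x + 1)
     else OAdd (ofund a x) OZero)"

lemma cnf_OAdd_iff:
  "cnf (OAdd a b) \<longleftrightarrow> cnf a \<and> cnf b \<and> (\<forall>c d. b = OAdd c d \<longrightarrow> c \<le> a)"
  by (cases b) auto

lemma cnf_OAdd_less:
  assumes "cnf (OAdd a b)" "cnf c" "c \<le> b"
  shows "cnf (OAdd a c)"
  using assms by (cases b; cases c) (auto simp: cnf_OAdd_iff less_eq_oterm_def intro: less_imp_le)

lemma OZero_le [simp]: "OZero \<le> t"
  by (cases t) (auto simp: less_eq_oterm_def)

lemma cnf_oplus: "cnf s \<Longrightarrow> cnf t \<Longrightarrow> cnf (oplus s t)"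
proof (induction s t rule: oplus.induct)
  case (3 a b c d)
  show ?case
  proof (cases "a < c")
    case False
    then have "cnf (oplus b (OAdd c d))" using 3 by (auto simp: cnf_OAdd_iff)
    then show ?thesis using 3 False
      by (cases b) (auto simp: cnf_OAdd_iff not_less split: if_splits)
  qed (use 3 in auto)
qed auto

lemma cnf_omult: "cnf a \<Longrightarrow> cnf (omult a n)"
proof (induction n)
  case (Suc n)
  then show ?case by (cases n) auto
qed auto

lemma opred_le: "opred t \<le> t"
  by (induction t) (auto simp: less_eq_oterm_def)

lemma cnf_opred: "cnf t \<Longrightarrow> cnf (opred t)"
proof (induction t)
  case (OAdd a b)
  then show ?case
    using cnf_OAdd_less[of a b "opred b"] opred_le[of b] by (auto simp: cnf_OAdd_iff)
qed auto

lemma opred_less: "osucc t \<Longrightarrow> opred t < t"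
  by (induction t) (auto split: if_splits)

lemma omult_less: "a < b \<Longrightarrow> omult a n < OAdd b OZero"
  by (cases n) auto

lemma ofund_less: "t \<noteq> OZero \<Longrightarrow> \<not> osucc t \<Longrightarrow> ofund t x < t"
proof (induction t)
  case (OAdd a b)
  then show ?case
    using omult_less[of "opred a" a "x + 1"] opred_less[of a]
    by (auto split: if_splits simp del: omult.simps)
qed auto

lemma ofund_le: "ofund t x \<le> t"
proof (induction t)
  case (OAdd a b)
  then show ?case
    using omult_less[of "opred a" a "x + 1"] opred_less[of a] ofund_less[of a x]
    by (auto split: if_splits simp: less_eq_oterm_def simp del: omult.simps)
qed auto

lemma cnf_ofund: "cnf t \<Longrightarrow> cnf (ofund t x)"
proof (induction t)
  case (OAdd a b)
  then show ?case
    using cnf_OAdd_less[of a b "ofund b x"] ofund_le[of b x] cnf_omult[OF cnf_opred, of a "x + 1"]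
    by (auto simp: cnf_OAdd_iff simp del: omult.simps)
qed auto

lemma wf_cnf: "wf {(s, t). cnf s \<and> cnf t \<and> s < t}" (is "wf ?R")
proof -
  let ?A = "Wellfounded.acc ?R"
  have zero: "OZero \<in> ?A"
    by (rule acc.intros) auto
  have exps: "\<forall>b. cnf (OAdd a b) \<longrightarrow> OAdd a b \<in> ?A" if "a \<in> ?A" for a
    using that
  proof (induction rule: acc.induct)
    case (accI a)
    have IH: "OAdd a' b' \<in> ?A" if "a' < a" "cnf a" "cnf (OAdd a' b')" for a' b'
      using accI(2)[of a'] that by (auto simp: cnf_OAdd_iff)
    have step: "cnf (OAdd a b) \<longrightarrow> OAdd a b \<in> ?A" if "b \<in> ?A" for b
      using that
    proof (induction rule: acc.induct)
      case inner: (accI b)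
      show ?case
      proof
        assume nf: "cnf (OAdd a b)"
        show "OAdd a b \<in> ?A"
        proof (rule acc.intros)
          fix s assume s: "(s, OAdd a b) \<in> ?R"
          show "s \<in> ?A"
          proof (cases s)
            case (OAdd a' b')
            then show ?thesis using s IH[of a' b'] inner(2)[of b'] nf
              by (auto simp: cnf_OAdd_iff)
          qed (use zero in simp)
        qed
      qed
    qed
    have tails: "cnf (OAdd a b) \<longrightarrow> b \<in> ?A" for b
    proof (induction b)
      case (OAdd c d)
      show ?case
      proof
        assume nf: "cnf (OAdd a (OAdd c d))"
        then have "c < a \<or> c = a" by (auto simp: less_eq_oterm_def)
        then show "OAdd c d \<in> ?A"
        proof
          assume "c < a"
          then show ?thesis using IH[of c d] nf by auto
        next
          assume "c = a"
          then show ?thesis using OAdd nf step[of d] by auto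
        qed
      qed
    qed (use zero in simp)
    show ?case using step tails by blast
  qed
  have all: "cnf t \<longrightarrow> t \<in> ?A" for t
    by (induction t) (auto simp: cnf_OAdd_iff zero dest!: exps)
  have "t \<in> ?A" for t
    by (cases "cnf t") (use all in \<open>auto intro: acc.intros\<close>)
  then show ?thesis by (rule acc_wfI[OF allI])
qed

typedef eps0 = "{t. cnf t}"
  morphisms rep_ord Ord
  by (rule exI[of _ OZero]) simp

lemma cnf_term_of [simp]: "cnf (rep_ord \<alpha>)"
  using rep_ord by auto

lemma rep_ord_Ord [simp]: "cnf t \<Longrightarrow> rep_ord (Ord t) = t"
  by (simp add: Ord_inverse)

instantiation eps0 :: wellorder
begin

definition less_eps0 :: "eps0 \<Rightarrow> eps0 \<Rightarrow> bool" where
  "\<alpha> < \<beta> \<longleftrightarrow> rep_ord \<alpha> < rep_ord \<beta>"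

definition less_eq_eps0 :: "eps0 \<Rightarrow> eps0 \<Rightarrow> bool" where
  "\<alpha> \<le> \<beta> \<longleftrightarrow> rep_ord \<alpha> \<le> rep_ord \<beta>"

instance
proof
  fix \<alpha> \<beta> \<gamma> :: eps0
  show "(\<alpha> < \<beta>) = (\<alpha> \<le> \<beta> \<and> \<not> \<beta> \<le> \<alpha>)"
    by (auto simp: less_eps0_def less_eq_eps0_def)
  show "\<alpha> \<le> \<alpha>" by (simp add: less_eq_eps0_def)
  show "\<alpha> \<le> \<beta> \<Longrightarrow> \<beta> \<le> \<gamma> \<Longrightarrow> \<alpha> \<le> \<gamma>" by (auto simp: less_eq_eps0_def)
  show "\<alpha> \<le> \<beta> \<Longrightarrow> \<beta> \<le> \<alpha> \<Longrightarrow> \<alpha> = \<beta>" by (simp add: less_eq_eps0_def rep_ord_inject)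
  show "\<alpha> \<le> \<beta> \<or> \<beta> \<le> \<alpha>" by (auto simp: less_eq_eps0_def)
next
  fix P :: "eps0 \<Rightarrow> bool" and \<alpha> :: eps0
  assume IH: "\<And>\<alpha>. (\<And>\<beta>. \<beta> < \<alpha> \<Longrightarrow> P \<beta>) \<Longrightarrow> P \<alpha>"
  have "wf (inv_image {(s, t). cnf s \<and> cnf t \<and> s < t} rep_ord)"
    by (intro wf_inv_image wf_cnf)
  then show "P \<alpha>"
  proof (induction \<alpha> rule: wf_induct_rule)
    case (less \<alpha>)
    show ?case by (rule IH, rule less) (simp add: less_eps0_def)
  qed
qed

end

instantiation eps0 :: "{zero, one, plus}"
begin

definition "0 = Ord OZero"
definition "1 = Ord (OAdd OZero OZero)"
definition "\<alpha> + \<beta> = Ord (oplus (rep_ord \<alpha>) (rep_ord \<beta>))"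

instance ..

end

definition is_succ :: "eps0 \<Rightarrow> bool" where
  "is_succ \<alpha> \<longleftrightarrow> (\<exists>\<gamma>. \<alpha> = \<gamma> + 1)"

definition pred :: "eps0 \<Rightarrow> eps0" where
  "pred \<alpha> = (THE \<gamma>. \<alpha> = \<gamma> + 1)"

definition is_limit :: "eps0 \<Rightarrow> bool" where
  "is_limit \<alpha> \<longleftrightarrow> \<alpha> \<noteq> 0 \<and> \<not> is_succ \<alpha>"

definition fund :: "eps0 \<Rightarrow> nat \<Rightarrow> eps0" where
  "fund \<alpha> x = Ord (ofund (rep_ord \<alpha>) x)"

lemma rep_ord_simps [simp]:
  "rep_ord 0 = OZero" "rep_ord 1 = OAdd OZero OZero"
  "rep_ord (\<alpha> + \<beta>) = oplus (rep_ord \<alpha>) (rep_ord \<beta>)"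
  "rep_ord (fund \<alpha> x) = ofund (rep_ord \<alpha>) x"
  by (simp_all add: zero_eps0_def one_eps0_def plus_eps0_def fund_def cnf_oplus cnf_ofund)

lemma oplus_OZero [simp]: "oplus t OZero = t"
  by (cases t) auto

lemma oplus_assoc: "oplus (oplus s t) u = oplus s (oplus t u)"
proof (induction s)
  case (OAdd a b)
  then show ?case by (cases t; cases u) auto
qed auto

instance eps0 :: monoid_add
  by intro_classes (simp_all add: rep_ord_inject[symmetric] oplus_assoc)

lemma oplus_one_facts:
  "osucc (oplus t (OAdd OZero OZero))" "opred (oplus t (OAdd OZero OZero)) = t"
proof -
  have *: "oplus s (OAdd OZero OZero) \<noteq> OZero" for s by (cases s) auto
  show "osucc (oplus t (OAdd OZero OZero))"
    by (induction t) (auto simp: *)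
  show "opred (oplus t (OAdd OZero OZero)) = t"
    by (induction t) (auto simp: *)
qed

lemma oplus_opred: "cnf t \<Longrightarrow> osucc t \<Longrightarrow> oplus (opred t) (OAdd OZero OZero) = t"
proof (induction t)
  case (OAdd a b)
  then show ?case by (auto simp: cnf_OAdd_iff split: if_splits)
qed auto

lemma succ_iff: "is_succ \<alpha> \<longleftrightarrow> osucc (rep_ord \<alpha>)"
proof
  assume "osucc (rep_ord \<alpha>)"
  then have "\<alpha> = Ord (opred (rep_ord \<alpha>)) + 1"
    by (simp add: rep_ord_inject[symmetric] cnf_opred oplus_opred)
  then show "is_succ \<alpha>" unfolding is_succ_def by blast
qed (auto simp: is_succ_def oplus_one_facts)

lemma pred_succ [simp]: "pred (\<gamma> + 1) = \<gamma>"
  unfolding pred_def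
proof (rule the_equality)
  fix \<delta> assume "\<gamma> + 1 = \<delta> + 1"
  then have "opred (rep_ord (\<gamma> + 1)) = opred (rep_ord (\<delta> + 1))" by simp
  then show "\<delta> = \<gamma>" by (simp add: oplus_one_facts rep_ord_inject)
qed simp

lemma pred_less: "is_succ \<alpha> \<Longrightarrow> pred \<alpha> < \<alpha>"
  using opred_less[OF oplus_one_facts(1)] oplus_one_facts(2)
  by (auto simp: is_succ_def less_eps0_def)

lemma fund_less: "is_limit \<alpha> \<Longrightarrow> fund \<alpha> x < \<alpha>"
  using ofund_less[of "rep_ord \<alpha>"]
  by (auto simp: is_limit_def succ_iff less_eps0_def simp flip: rep_ord_inject)

lemma succ_le_iff: "\<gamma> + 1 \<le> \<delta> \<longleftrightarrow> \<gamma> < (\<delta> :: eps0)"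
proof -
  have lt: "t < oplus t (OAdd OZero OZero)" for t
    by (induction t) auto
  have "s < t \<Longrightarrow> oplus s (OAdd OZero OZero) \<le> t" for s t
  proof (induction s arbitrary: t)
    case OZero
    then obtain c d where "t = OAdd c d" by (cases t) auto
    then show ?case
      using OZero_le[of c] OZero_le[of d] by (auto simp: less_eq_oterm_def simp del: OZero_le)
  next
    case (OAdd a b)
    then show ?case by (cases t) (auto simp: less_eq_oterm_def)
  qed
  then show ?thesis using lt[of "rep_ord \<gamma>"]
    by (auto simp: less_eps0_def less_eq_eps0_def dest: less_le_trans[OF lt])
qed


section \<open>Fast-growing functions\<close>

text \<open>The recursion equations for the three kinds of ordinals are restated as lemmas below.\<close>

function rel_fast :: "(nat \<Rightarrow> nat) \<Rightarrow> eps0 \<Rightarrow> nat \<Rightarrow> nat" where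
  "rel_fast h \<alpha> =
    (if \<alpha> = 0 then h
     else if is_succ \<alpha> then (\<lambda>x. (rel_fast h (pred \<alpha>) ^^ (x + 1)) x)
     else (\<lambda>x. rel_fast h (fund \<alpha> x) x))"
  by pat_completeness auto
termination
proof (relation "inv_image {(\<alpha>, \<beta>). \<alpha> < \<beta>} snd")
  show "wf (inv_image {(\<alpha> :: eps0, \<beta>). \<alpha> < \<beta>} snd)"
    by (intro wf_inv_image wf)
qed (auto simp: pred_less is_limit_def intro: fund_less)

declare rel_fast.simps [simp del]

lemma zero_not_succ: "\<not> is_succ 0"
  by (simp add: succ_iff)

lemma rel_fast_zero: "rel_fast h 0 x = h x"
  by (simp add: rel_fast.simps)

lemma rel_fast_succ: "rel_fast h (\<alpha> + 1) x = (rel_fast h \<alpha> ^^ (x + 1)) x"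
proof -
  have "is_succ (\<alpha> + 1)" by (auto simp: is_succ_def)
  moreover from this have "\<alpha> + 1 \<noteq> 0" using zero_not_succ by metis
  ultimately show ?thesis by (simp add: rel_fast.simps[of h "\<alpha> + 1"])
qed

lemma rel_fast_limit: "is_limit \<alpha> \<Longrightarrow> rel_fast h \<alpha> x = rel_fast h (fund \<alpha> x) x"
  by (subst rel_fast.simps) (simp add: is_limit_def)

definition fast :: "eps0 \<Rightarrow> nat \<Rightarrow> nat" where
  "fast = rel_fast (\<lambda>x. x + 1)"


section \<open>The extended Grzegorczyk hierarchy\<close>

text \<open>
  \<open>grz \<alpha> k f\<close>: the \<open>k\<close>-ary function represented by \<open>f\<close> lies in the class of index \<open>\<alpha>\<close>.  Only the
  values of \<open>f\<close> on lists of length \<open>k\<close> matter, whence the rule \<open>ext\<close>.  In limited primitive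
  recursion (\<open>limrec\<close>) the recursion variable is the first argument.
\<close>

inductive grz :: "eps0 \<Rightarrow> nat \<Rightarrow> (nat list \<Rightarrow> nat) \<Rightarrow> bool" for \<alpha> :: eps0 where
  zero: "grz \<alpha> k (\<lambda>xs. 0)"
| add: "grz \<alpha> 2 (\<lambda>xs. xs ! 0 + xs ! 1)"
| proj: "i < k \<Longrightarrow> grz \<alpha> k (\<lambda>xs. xs ! i)"
| fast: "grz \<alpha> 1 (\<lambda>xs. fast \<alpha> (xs ! 0))"
| comp: "grz \<alpha> (length gs) f \<Longrightarrow> (\<forall>g \<in> set gs. grz \<alpha> k g) \<Longrightarrow>
    grz \<alpha> k (\<lambda>xs. f (map (\<lambda>g. g xs) gs))"
| limrec: "grz \<alpha> k f\<^sub>0 \<Longrightarrow> grz \<alpha> (k + 2) f\<^sub>1 \<Longrightarrow> grz \<alpha> 1 b \<Longrightarrow>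
    (\<And>xs. length xs = k \<Longrightarrow> f (0 # xs) = f\<^sub>0 xs) \<Longrightarrow>
    (\<And>y xs. length xs = k \<Longrightarrow> f (Suc y # xs) = f\<^sub>1 (y # f (y # xs) # xs)) \<Longrightarrow>
    (\<And>y xs. length xs = k \<Longrightarrow> f (y # xs) \<le> b [Max (set (y # xs))]) \<Longrightarrow>
    grz \<alpha> (k + 1) f"
| ext: "grz \<alpha> k f \<Longrightarrow> (\<And>xs. length xs = k \<Longrightarrow> g xs = f xs) \<Longrightarrow> grz \<alpha> k g"

definition Grz1 :: "eps0 \<Rightarrow> (nat \<Rightarrow> nat) set" where
  "Grz1 \<alpha> = {p. grz \<alpha> 1 (\<lambda>xs. p (xs ! 0))}"

definition Grz1_below :: "eps0 \<Rightarrow> (nat \<Rightarrow> nat) set" where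
  "Grz1_below \<alpha> = (\<Union>\<beta> \<in> {..<\<alpha>}. Grz1 \<beta>)"


section \<open>Deterministic time\<close>

text \<open>
  Deterministic Turing machines with any fixed number \<open>k \<ge> 1\<close> of two-way infinite tapes; the first
  tape initially carries the input, the head being on its first letter.  The finite type \<open>'a\<close> is the
  input alphabet.  The tape alphabet \<open>syms\<close> and the state set \<open>states\<close> are arbitrary finite sets;
  work symbols and states are named by natural numbers.
\<close>

datatype 'a sym = Blank | Inp 'a | Work nat

datatype move = MLeft | MStay | MRight

record 'a tm =
  tapes :: nat
  states :: "nat set"
  syms :: "'a sym set"
  start :: nat
  accept :: nat
  reject :: nat
  delta :: "nat \<Rightarrow> 'a sym list \<Rightarrow> nat \<times> ('a sym \<times> move) list"

definition is_tm :: "'a tm \<Rightarrow> bool" where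
  "is_tm M \<longleftrightarrow>
     tapes M \<ge> 1 \<and> finite (states M) \<and> finite (syms M) \<and>
     {start M, accept M, reject M} \<subseteq> states M \<and> accept M \<noteq> reject M \<and>
     insert Blank (range Inp) \<subseteq> syms M \<and>
     (\<forall>q \<in> states M. \<forall>ss. length ss = tapes M \<and> set ss \<subseteq> syms M \<longrightarrow>
        fst (delta M q ss) \<in> states M \<and>
        length (snd (delta M q ss)) = tapes M \<and>
        fst ` set (snd (delta M q ss)) \<subseteq> syms M)"

type_synonym 'a config = "nat \<times> ((int \<Rightarrow> 'a sym) \<times> int) list"

fun head_shift :: "move \<Rightarrow> int" where
  "head_shift MLeft = - 1"
| "head_shift MStay = 0"
| "head_shift MRight = 1"

definition halted :: "'a tm \<Rightarrow> 'a config \<Rightarrow> bool" where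
  "halted M c \<longleftrightarrow> fst c \<in> {accept M, reject M}"

definition step :: "'a tm \<Rightarrow> 'a config \<Rightarrow> 'a config" where
  "step M c =
    (if halted M c then c
     else let (q, as) = delta M (fst c) (map (\<lambda>(t, i). t i) (snd c))
       in (q, map2 (\<lambda>(t, i) (s, m). (t(i := s), i + head_shift m)) (snd c) as))"

definition init :: "'a tm \<Rightarrow> 'a list \<Rightarrow> 'a config" where
  "init M w =
    (start M,
     ((\<lambda>i. if 0 \<le> i \<and> i < int (length w) then Inp (w ! nat i) else Blank), 0)
     # replicate (tapes M - 1) (\<lambda>_. Blank, 0))"

definition decides_in_time :: "'a tm \<Rightarrow> 'a list set \<Rightarrow> (nat \<Rightarrow> nat) \<Rightarrow> bool" where
  "decides_in_time M L t \<longleftrightarrow>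
    (\<forall>w. \<exists>s \<le> t (length w). let c = (step M ^^ s) (init M w) in
       halted M c \<and> (fst c = accept M \<longleftrightarrow> w \<in> L))"

definition DTime :: "(nat \<Rightarrow> nat) \<Rightarrow> 'a::finite list set set" where
  "DTime t = {L. \<exists>M. is_tm M \<and> decides_in_time M L t}"


section \<open>The complexity classes\<close>

definition FC :: "eps0 \<Rightarrow> 'a::finite list set set" where
  "FC \<alpha> = (\<Union>p \<in> Grz1_below \<alpha>. DTime (\<lambda>n. fast \<alpha> (p n)))"

definition rel_FC :: "(nat \<Rightarrow> nat) \<Rightarrow> eps0 \<Rightarrow> 'a::finite list set set" where
  "rel_FC h \<alpha> = (\<Union>p \<in> Grz1_below \<alpha>. DTime (\<lambda>n. rel_fast h \<alpha> (p n)))"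

end

theory Submission
  imports Defs
begin

text \<open>
  If all coefficients in the Cantor normal form of \<open>\<gamma> < \<lambda>\<close>, \<open>\<lambda>\<close> a limit, are hereditarily at most \<open>x\<close>,
  then \<open>\<gamma> < \<lambda>(x)\<close>; hence the fast-growing functions increase with their index at all arguments
  beyond the coefficients of the smaller index.  By induction on \<open>\<alpha>\<close>, an inequality
  \<open>\<phi> \<circ> F\<^bsub>h,\<alpha>\<^sub>0\<^esub> \<le> F\<^bsub>\<beta>+\<alpha>\<^sub>0\<^esub> \<circ> \<phi>\<close> then extends to all \<open>\<alpha> \<ge> \<alpha>\<^sub>0\<close>.  For (ii) it holds at \<open>\<alpha>\<^sub>0 = 0\<close> with
  \<open>\<phi>(x) = x + c\<close>.  For (i), \<open>h\<close> is eventually below an iterate \<open>F\<^sup>k\<close> of \<open>F = F\<^bsub>\<beta>+1\<^esub>\<close>, and it holds at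
  \<open>\<alpha>\<^sub>0 = 1\<close> (with \<open>\<beta> + 1\<close> for \<open>\<beta>\<close>) with \<open>\<phi>(x) = k (x + c)\<close>.  The inner function \<open>p\<close> is only replaced by a
  majorant, so monotonicity of the Grzegorczyk hierarchy under inclusion is not needed.
\<close>

section \<open>Ordinals with bounded coefficients\<close>

fun ocoeff :: "oterm \<Rightarrow> oterm \<Rightarrow> nat" where
  "ocoeff c OZero = 0"
| "ocoeff c (OAdd a b) = (if a = c then 1 else 0) + ocoeff c b"

text \<open>
  On normal forms, \<open>olean n\<close> says that all coefficients, hereditarily also those in the exponents,
  are at most \<open>n\<close>.
\<close>

fun olean :: "nat \<Rightarrow> oterm \<Rightarrow> bool" where
  "olean n OZero \<longleftrightarrow> True"
| "olean n (OAdd a b) \<longleftrightarrow> olean n a \<and> olean n b \<and> ocoeff a b < n"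

lemma olean_mono: "olean m t \<Longrightarrow> m \<le> n \<Longrightarrow> olean n t"
  by (induction t) auto

lemma ex_olean: "\<exists>n. olean n t"
proof (induction t)
  case (OAdd a b)
  then obtain m n where "olean m a" "olean n b" by blast
  then have "olean (m + n + ocoeff a b + 1) (OAdd a b)"
    by (auto elim: olean_mono)
  then show ?case by blast
qed auto

lemma ocoeff_opred: "ocoeff c (opred t) \<le> ocoeff c t"
  by (induction t) auto

lemma olean_opred: "olean n t \<Longrightarrow> olean n (opred t)"
proof (induction t)
  case (OAdd a b)
  then show ?case using ocoeff_opred[of a b] by auto
qed auto

lemma ocoeff_omult: "ocoeff c (omult a n) = (if c = a then n else 0)"
  by (induction n) auto

lemma olean_omult: "olean n a \<Longrightarrow> m \<le> n \<Longrightarrow> olean n (omult a m)"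
  by (induction m) (auto simp: ocoeff_omult)

text \<open>The summands replacing the last one have exponents strictly below its exponent, which in
  normal form is at most \<open>a\<close>; so no new summand with exponent \<open>a\<close>
  arises.\<close>

lemma ocoeff_ofund: "cnf (OAdd a b) \<Longrightarrow> ocoeff a (ofund b x) \<le> ocoeff a b"
proof (induction b)
  case (OAdd c d)
  have "c \<le> a" "cnf (OAdd a d)" using OAdd.prems(1)
    by (auto simp: cnf_OAdd_iff intro: order_trans)
  consider "d \<noteq> OZero" | "d = OZero" "c = OZero" | "d = OZero" "c \<noteq> OZero" "osucc c"
    | "d = OZero" "c \<noteq> OZero" "\<not> osucc c" by blast
  then show ?case
  proof cases
    case 1
    then show ?thesis using OAdd.IH(2)[OF \<open>cnf (OAdd a d)\<close>] by simp
  next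
    case 3
    then have "a \<noteq> opred c" using opred_less[of c] \<open>c \<le> a\<close> by auto
    with 3 show ?thesis by (simp add: ocoeff_omult del: omult.simps)
  next
    case 4
    then have "ofund c x \<noteq> a" using ofund_less[of c x] \<open>c \<le> a\<close> by auto
    with 4 show ?thesis by simp
  qed simp
qed auto

text \<open>The only new coefficient is the \<open>x + 1\<close> of
  \<open>omult (opred a) (x + 1)\<close>; hence the bound \<open>x + 1\<close>.\<close>

lemma olean_ofund: "cnf t \<Longrightarrow> olean (x + 1) t \<Longrightarrow> olean (x + 1) (ofund t x)"
proof (induction t)
  case (OAdd a b)
  then have "cnf a" "cnf b" by (simp_all add: cnf_OAdd_iff)
  show ?case
  proof (cases "b = OZero")
    case True
    have "olean (x + 1) (omult (opred a) (x + 1))"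
      using OAdd.prems by (intro olean_omult olean_opred) auto
    then show ?thesis using True OAdd.IH(1) OAdd.prems \<open>cnf a\<close> by (simp del: omult.simps)
  next
    case False
    then show ?thesis
      using OAdd.IH(2) OAdd.prems \<open>cnf b\<close> ocoeff_ofund[OF OAdd.prems(1), of x] by simp
  qed
qed auto

lemma ocoeff_oplus: "ocoeff c (oplus s t) \<le> ocoeff c s + ocoeff c t"
  by (induction s t rule: oplus.induct) auto

lemma olean_oplus: "olean m s \<Longrightarrow> olean n t \<Longrightarrow> olean (m + n) (oplus s t)"
proof (induction s t rule: oplus.induct)
  case (1 t)
  show ?case using olean_mono[OF 1(2), of "m + n"] by simp
next
  case (2 a b)
  show ?case using olean_mono[OF 2(1), of "m + n"] by simp
next
  case (3 a b c d)
  show ?case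
  proof (cases "a < c")
    case True
    then show ?thesis using olean_mono[OF 3(3), of "m + n"] by simp
  next
    case False
    have *: "olean n u \<Longrightarrow> ocoeff a u \<le> n" for u
      by (induction u) auto
    have "ocoeff a (oplus b (OAdd c d)) \<le> ocoeff a b + n"
      using ocoeff_oplus[of a b "OAdd c d"] *[OF 3(3)] by linarith
    moreover have "olean m a" "olean m b" "ocoeff a b < m" using 3(2) by simp_all
    moreover have "olean (m + n) (oplus b (OAdd c d))"
      using 3 \<open>olean m b\<close> False by blast
    ultimately show ?thesis using olean_mono[of m a "m + n"] False by simp
  qed
qed

lemma oplus_strict_mono: "t < u \<Longrightarrow> oplus s t < oplus s u"
proof (induction s)
  case (OAdd a b)
  then show ?case by (cases t; cases u) auto
qed auto

lemma le_opred:
  assumes "cnf s" "cnf t" "osucc t" "s < t"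
  shows "s \<le> opred t"
proof (rule ccontr)
  assume "\<not> s \<le> opred t"
  then have "Ord (opred t) < Ord s"
    using assms by (simp add: less_eps0_def cnf_opred)
  then have "Ord (opred t) + 1 \<le> Ord s"
    by (simp add: succ_le_iff)
  then show False
    using assms by (simp add: less_eq_eps0_def cnf_opred oplus_opred)
qed

text \<open>Along \<open>d\<close>, each leading exponent equal to \<open>c\<close> uses up one of
  the \<open>n\<close> copies; at the first smaller exponent, or at the end, a copy is still
  left.\<close>

lemma less_omult: "cnf (OAdd c d) \<Longrightarrow> ocoeff c d < n \<Longrightarrow> d < omult c n"
proof (induction d arbitrary: n)
  case OZero
  then show ?case by (cases n) auto
next
  case (OAdd e f)
  have "e \<le> c" "cnf (OAdd c f)" using OAdd.prems(1)
    by (auto simp: cnf_OAdd_iff intro: order_trans)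
  obtain k where n: "n = Suc k" using OAdd.prems(2) by (cases n) auto
  show ?case
  proof (cases "e = c")
    case True
    then show ?thesis using OAdd.IH(2)[OF \<open>cnf (OAdd c f)\<close>, of k] OAdd.prems(2) n by simp
  next
    case False
    then show ?thesis using \<open>e \<le> c\<close> n by simp
  qed
qed

text \<open>The induction moves to the last summand of \<open>t\<close>. If its exponent is a limit,
  the comparison continues in the exponent, which is why leanness is hereditary.\<close>

lemma less_ofund:
  assumes "cnf s" "cnf t" "t \<noteq> OZero" "\<not> osucc t" "s < t" "olean x s"
  shows "s < ofund t x"
  using assms
proof (induction t arbitrary: s)
  case (OAdd a b)
  show ?case
  proof (cases s)
    case OZero
    then show ?thesis using OAdd.IH(2)[of OZero] OAdd.prems by (cases b) auto
  next
    case s: (OAdd c d)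
    show ?thesis
    proof (cases "b = OZero")
      case False
      then show ?thesis using OAdd s by (auto simp: cnf_OAdd_iff)
    next
      case b: True
      then have "c < a" "a \<noteq> OZero" using OAdd.prems s by auto
      show ?thesis
      proof (cases "osucc a")
        case True
        then have "c \<le> opred a"
          using le_opred[of c a] OAdd.prems s \<open>c < a\<close> by (auto simp: cnf_OAdd_iff)
        \<comment> \<open>If \<open>c = opred a\<close>, the head of \<open>s\<close> matches one of
          the \<open>x + 1\<close> copies and leaves \<open>x\<close> of them for the tail
          \<open>d\<close>: just what the coefficient bound allows.\<close>
        moreover have "d < omult c x"
          using less_omult[of c d x] OAdd.prems s by auto
        ultimately show ?thesis
          using b s \<open>a \<noteq> OZero\<close> True by (auto simp: less_eq_oterm_def)
      next
        case False
        then show ?thesis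
          using OAdd.IH(1)[of c] OAdd.prems s b \<open>c < a\<close> \<open>a \<noteq> OZero\<close>
          by (auto simp: cnf_OAdd_iff)
      qed
    qed
  qed
qed auto

section \<open>Transfer from terms to \<open>eps0\<close>\<close>

definition lean :: "nat \<Rightarrow> eps0 \<Rightarrow> bool" where
  "lean n \<alpha> \<longleftrightarrow> olean n (rep_ord \<alpha>)"

lemma lean_zero [simp]: "lean n 0"
  by (simp add: lean_def)

lemma lean_mono: "lean m \<alpha> \<Longrightarrow> m \<le> n \<Longrightarrow> lean n \<alpha>"
  by (auto simp: lean_def elim: olean_mono)

lemma ex_lean: "\<exists>n. lean n \<alpha>"
  by (simp add: lean_def ex_olean)

lemma lean_add: "lean m \<alpha> \<Longrightarrow> lean n \<beta> \<Longrightarrow> lean (m + n) (\<alpha> + \<beta>)"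
  by (simp add: lean_def olean_oplus)

lemma lean_succD: "lean n (\<alpha> + 1) \<Longrightarrow> lean n \<alpha>"
  using olean_opred[of n "rep_ord (\<alpha> + 1)"] by (simp add: lean_def oplus_one_facts)

lemma lean_fund: "lean (x + 1) \<alpha> \<Longrightarrow> lean (x + 1) (fund \<alpha> x)"
  using olean_ofund[of "rep_ord \<alpha>" x] by (simp add: lean_def)

lemma less_fund: "is_limit \<alpha> \<Longrightarrow> \<gamma> < \<alpha> \<Longrightarrow> lean x \<gamma> \<Longrightarrow> \<gamma> < fund \<alpha> x"
  using less_ofund[of "rep_ord \<gamma>" "rep_ord \<alpha>" x]
  by (auto simp: is_limit_def succ_iff less_eps0_def lean_def simp flip: rep_ord_inject)

lemma eps0_zero_le [simp]: "0 \<le> (\<alpha> :: eps0)"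
  by (simp add: less_eq_eps0_def)

lemma eps0_not_less_zero [simp]: "\<not> \<alpha> < (0 :: eps0)"
  by (simp add: not_less)

lemma eps0_add_strict_mono: "\<gamma> < \<delta> \<Longrightarrow> \<beta> + \<gamma> < \<beta> + (\<delta> :: eps0)"
  by (simp add: less_eps0_def oplus_strict_mono)

lemma less_succ_iff: "\<gamma> < \<delta> + 1 \<longleftrightarrow> \<gamma> \<le> (\<delta> :: eps0)"
proof
  assume "\<gamma> < \<delta> + 1"
  then show "\<gamma> \<le> \<delta>" using succ_le_iff[of \<delta> \<gamma>] by (meson leD not_less)
next
  assume "\<gamma> \<le> \<delta>"
  moreover have "\<delta> < \<delta> + 1" by (simp flip: succ_le_iff)
  ultimately show "\<gamma> < \<delta> + 1" by simp
qed

lemma eps0_induct [case_names zero succ limit]: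
  assumes "P 0" "\<And>\<gamma>. P \<gamma> \<Longrightarrow> P (\<gamma> + 1)"
    and "\<And>\<gamma>. is_limit \<gamma> \<Longrightarrow> (\<And>x. P (fund \<gamma> x)) \<Longrightarrow> P \<gamma>"
  shows "P (\<alpha> :: eps0)"
proof (induction \<alpha> rule: less_induct)
  case (less \<alpha>)
  consider "\<alpha> = 0" | \<gamma> where "\<alpha> = \<gamma> + 1" | "is_limit \<alpha>"
    unfolding is_limit_def is_succ_def by blast
  then show ?case
  proof cases
    case 2
    then show ?thesis using assms(2)[OF less] by (simp add: less_succ_iff)
  qed (use assms less fund_less in auto)
qed


section \<open>Monotonicity of the fast-growing functions\<close>

lemma le_funpow: "(\<And>x. x \<le> f x) \<Longrightarrow> x \<le> (f ^^ i) (x :: nat)"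
proof (induction i)
  case (Suc i)
  have "x \<le> f ((f ^^ i) x)" using Suc.IH[OF Suc.prems] Suc.prems by (rule order_trans)
  then show ?case by simp
qed simp

lemma le_funpow_Suc: "(\<And>x. x \<le> f x) \<Longrightarrow> f x \<le> (f ^^ (i + 1)) (x :: nat)"
proof -
  assume "\<And>x. x \<le> f x"
  then have "f x \<le> (f ^^ i) (f x)" by (rule le_funpow)
  then show ?thesis by (simp add: funpow_swap1)
qed

lemma funpow_increasing:
  assumes "\<And>x. x \<le> f x" "i \<le> j"
  shows "(f ^^ i) x \<le> (f ^^ j) (x :: nat)"
proof -
  obtain d where "j = d + i" using \<open>i \<le> j\<close> by (metis le_add_diff_inverse2)
  moreover have "(f ^^ i) x \<le> (f ^^ d) ((f ^^ i) x)" using assms(1) by (rule le_funpow)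
  ultimately show ?thesis by (simp add: funpow_add)
qed

text \<open>Comparing at all \<open>u \<le> v\<close> above \<open>n\<close> merges domination with
  monotonicity, so the bound iterates; the orbit of the inflationary \<open>g\<close> stays above
  \<open>n\<close>.\<close>

lemma funpow_le:
  fixes f g :: "nat \<Rightarrow> nat"
  assumes "\<And>u v. n \<le> u \<Longrightarrow> u \<le> v \<Longrightarrow> g u \<le> f v" "\<And>u. u \<le> g u" "n \<le> x" "x \<le> y"
  shows "(g ^^ i) x \<le> (f ^^ i) y"
proof (induction i)
  case (Suc i)
  have "n \<le> (g ^^ i) x" using assms(3) le_funpow[OF assms(2)] by (rule order_trans)
  then show ?case using assms(1)[OF _ Suc.IH] by simp
qed (use assms in simp)

lemma rel_fast_ge:
  assumes "\<And>x. x \<le> h x"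
  shows "x \<le> rel_fast h \<alpha> x"
proof (induction \<alpha> arbitrary: x rule: eps0_induct)
  case (succ \<gamma>)
  then show ?case unfolding rel_fast_succ by (rule le_funpow)
qed (auto simp: rel_fast_zero rel_fast_limit assms)

text \<open>With \<open>x\<close> fixed, the descent from the larger index passes through
  predecessors and the ordinals \<open>fund \<delta> x\<close>; by \<open>less_fund\<close> it
  cannot jump over an \<open>x\<close>-lean index.\<close>

lemma rel_fast_index_mono:
  assumes "\<And>x. x \<le> h x" "\<gamma> \<le> \<alpha>" "lean x \<gamma>"
  shows "rel_fast h \<gamma> x \<le> rel_fast h \<alpha> x"
  using assms(2)
proof (induction \<alpha> rule: eps0_induct)
  case zero
  then have "\<gamma> = 0" by (intro antisym) simp_all
  then show ?case by simp
next
  case (succ \<delta>)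
  show ?case
  proof (cases "\<gamma> = \<delta> + 1")
    case False
    have "\<gamma> \<le> \<delta>"
      using le_neq_trans[OF succ.prems False] by (simp only: less_succ_iff)
    then have "rel_fast h \<gamma> x \<le> rel_fast h \<delta> x" by (rule succ.IH)
    also have "\<dots> \<le> rel_fast h (\<delta> + 1) x"
      unfolding rel_fast_succ using rel_fast_ge[OF assms(1)] by (rule le_funpow_Suc)
    finally show ?thesis .
  qed simp
next
  case (limit \<delta>)
  show ?case
  proof (cases "\<gamma> = \<delta>")
    case False
    then show ?thesis
      using limit.IH[of x] less_fund[OF limit.hyps le_neq_trans[OF limit.prems False] assms(3)]
      by (simp add: rel_fast_limit limit.hyps)
  qed simp
qed

text \<open>Monotonicity in an additive form, with which a shift of the argument can later be
  commuted. At a limit, both sides are compared through the same member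
  \<open>fund \<gamma> x\<close>.\<close>

lemma rel_fast_add_le:
  assumes h: "strict_mono h" and "lean (x + 1) \<alpha>"
  shows "rel_fast h \<alpha> x + d \<le> rel_fast h \<alpha> (x + d)"
  using assms(2)
proof (induction \<alpha> arbitrary: x d rule: eps0_induct)
  case zero
  have "h x + d \<le> h (x + d)"
  proof (induction d)
    case (Suc d)
    have "h (x + d) < h (x + Suc d)" using h by (simp add: strict_mono_def)
    then show ?case using Suc by simp
  qed simp
  then show ?case by (simp add: rel_fast_zero)
next
  case (succ \<gamma>)
  let ?F = "rel_fast h \<gamma>"
  have ge: "y \<le> ?F y" for y
    using h by (intro rel_fast_ge) (rule strict_mono_imp_increasing)
  have le: "?F u + e \<le> ?F (u + e)" if "x \<le> u" for u e
    using that succ by (intro succ.IH) (auto intro: lean_mono dest: lean_succD)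
  have "(?F ^^ i) x + d \<le> (?F ^^ i) (x + d)" for i
  proof (induction i)
    case (Suc i)
    have x: "x \<le> (?F ^^ i) x" using ge by (rule le_funpow)
    have "?F ((?F ^^ i) x) + d \<le> ?F ((?F ^^ i) x) + ((?F ^^ i) (x + d) - (?F ^^ i) x)"
      using Suc by simp
    also have "\<dots> \<le> ?F ((?F ^^ i) (x + d))"
      using le[OF x, of "(?F ^^ i) (x + d) - (?F ^^ i) x"] Suc by simp
    finally show ?case by simp
  qed simp
  from this[of "x + 1"] have "(?F ^^ (x + 1)) x + d \<le> (?F ^^ (x + 1)) (x + d)" .
  also have "\<dots> \<le> (?F ^^ (x + d + 1)) (x + d)"
    using ge by (rule funpow_increasing) simp
  finally show ?case by (simp only: rel_fast_succ)
next
  case (limit \<gamma>)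
  show ?case
  proof (cases "d = 0")
    case False
    have lean: "lean (x + 1) (fund \<gamma> x)" using limit.prems by (rule lean_fund)
    have "rel_fast h (fund \<gamma> x) x + d \<le> rel_fast h (fund \<gamma> x) (x + d)"
      by (rule limit.IH) (rule lean)
    \<comment> \<open>The smaller index is lean for \<open>x + 1\<close> and the comparison takes
      place at \<open>x + d\<close>, so \<open>d\<close> has to be positive.\<close>
    also have "\<dots> \<le> rel_fast h \<gamma> (x + d)"
      using fund_less[OF limit.hyps, of x] lean False
      by (intro rel_fast_index_mono strict_mono_imp_increasing[OF h])
        (auto elim: lean_mono)
    finally show ?thesis by (simp add: rel_fast_limit limit.hyps)
  qed simp
qed

lemma fast_index_mono: "\<gamma> \<le> \<alpha> \<Longrightarrow> lean x \<gamma> \<Longrightarrow> fast \<gamma> x \<le> fast \<alpha> x"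
  unfolding fast_def by (rule rel_fast_index_mono) simp

lemma fast_gt: "x < fast \<alpha> x"
  using fast_index_mono[of 0 \<alpha> x] by (simp add: fast_def rel_fast_zero)

lemma fast_ge: "x \<le> fast \<alpha> x"
  using fast_gt[of x \<alpha>] by simp

lemma fast_add_le: "lean (x + 1) \<alpha> \<Longrightarrow> fast \<alpha> x + d \<le> fast \<alpha> (x + d)"
  unfolding fast_def by (rule rel_fast_add_le) (auto simp: strict_mono_def)

lemma fast_mono: "lean (x + 1) \<alpha> \<Longrightarrow> x \<le> y \<Longrightarrow> fast \<alpha> x \<le> fast \<alpha> y"
  using fast_add_le[of x \<alpha> "y - x"] by simp

lemma fast_succ: "fast (\<alpha> + 1) x = (fast \<alpha> ^^ (x + 1)) x"
  by (simp add: fast_def rel_fast_succ)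

lemma add_le_funpow: "(\<And>x. x < f x) \<Longrightarrow> x + i \<le> (f ^^ i) (x :: nat)"
proof (induction i)
  case (Suc i)
  have "x + i < f ((f ^^ i) x)" using Suc.IH[OF Suc.prems] Suc.prems by (rule le_less_trans)
  then show ?case by simp
qed simp

lemma fast_succ_ge: "2 * x + 1 \<le> fast (\<alpha> + 1) x"
  using add_le_funpow[of "fast \<alpha>" x "x + 1"] fast_gt by (simp add: fast_succ del: funpow.simps)


section \<open>Comparison of relativized and plain functions\<close>

text \<open>
  Since \<open>\<beta> + \<alpha>(x)\<close> may exceed \<open>(\<beta> + \<alpha>)(x)\<close> when \<open>\<alpha>\<close> absorbs part of \<open>\<beta>\<close>, the argument is moved by
  \<open>\<phi>\<close>, and the inequality is made to commute with \<open>\<phi>\<close> so that it survives iteration.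
\<close>

lemma rel_fast_le_fast_add:
  assumes h: "\<And>x. x \<le> h x"
    and \<beta>: "lean c \<beta>"
    and \<phi>: "\<And>x. x + c + 1 \<le> \<phi> x"
    and "\<alpha>\<^sub>0 \<le> 1"
    and base: "\<And>x. n \<le> x \<Longrightarrow> \<phi> (rel_fast h \<alpha>\<^sub>0 x) \<le> fast (\<beta> + \<alpha>\<^sub>0) (\<phi> x)"
    and "\<alpha>\<^sub>0 \<le> \<alpha>" "lean (x + 1) \<alpha>" "n \<le> x"
  shows "\<phi> (rel_fast h \<alpha> x) \<le> fast (\<beta> + \<alpha>) (\<phi> x)"
  using assms(6-)
proof (induction \<alpha> arbitrary: x rule: eps0_induct)
  case zero
  then have "\<alpha>\<^sub>0 = 0" by (intro antisym) simp_all
  then show ?case using base zero by simp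
next
  case (succ \<gamma>)
  show ?case
  proof (cases "\<alpha>\<^sub>0 = \<gamma> + 1")
    case True
    then show ?thesis using base succ by simp
  next
    case False
    have \<gamma>: "\<alpha>\<^sub>0 \<le> \<gamma>"
      using le_neq_trans[OF succ.prems(1) False] by (simp only: less_succ_iff)
    let ?G = "rel_fast h \<gamma>" and ?F = "fast (\<beta> + \<gamma>)"
    have "\<phi> ((?G ^^ i) x) \<le> (?F ^^ i) (\<phi> x)" for i
    proof (induction i)
      case (Suc i)
      let ?y = "(?G ^^ i) x"
      have y: "x \<le> ?y" by (intro le_funpow rel_fast_ge h)
      have lean: "lean (?y + 1) \<gamma>"
        by (rule lean_mono[OF lean_succD[OF succ.prems(2)]]) (use y in simp)
      have "\<phi> (?G ?y) \<le> ?F (\<phi> ?y)"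
        using \<gamma> lean y succ.prems by (intro succ.IH) auto
      also have "\<dots> \<le> ?F ((?F ^^ i) (\<phi> x))"
      proof (rule fast_mono)
        show "lean (\<phi> ?y + 1) (\<beta> + \<gamma>)"
          by (rule lean_mono[OF lean_add[OF \<beta> lean]]) (use \<phi>[of ?y] in simp)
      qed (rule Suc)
      finally show ?case by simp
    qed simp
    from this[of "x + 1"] have "\<phi> (rel_fast h (\<gamma> + 1) x) \<le> (?F ^^ (x + 1)) (\<phi> x)"
      by (simp only: rel_fast_succ)
    also have "\<dots> \<le> (?F ^^ (\<phi> x + 1)) (\<phi> x)"
      using \<phi>[of x] by (intro funpow_increasing fast_ge) simp
    also have "\<dots> = fast (\<beta> + (\<gamma> + 1)) (\<phi> x)"
      by (simp only: fast_succ flip: add.assoc)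
    finally show ?thesis .
  qed
next
  case (limit \<gamma>)
  have "0 < \<gamma>" using limit.hyps by (simp add: is_limit_def order.strict_iff_order)
  \<comment> \<open>Members of the fundamental sequence of a limit are nonzero, so
    \<open>\<alpha>\<^sub>0 \<le> 1\<close> makes the induction hypothesis available for all of
    them.\<close>
  then have "0 + 1 \<le> fund \<gamma> x"
    using less_fund[OF limit.hyps, of 0] unfolding succ_le_iff by simp
  then have ge: "\<alpha>\<^sub>0 \<le> fund \<gamma> x" using \<open>\<alpha>\<^sub>0 \<le> 1\<close> by simp
  have lean: "lean (x + 1) (fund \<gamma> x)" using limit.prems(2) by (rule lean_fund)
  have "\<phi> (rel_fast h (fund \<gamma> x) x) \<le> fast (\<beta> + fund \<gamma> x) (\<phi> x)"
    by (rule limit.IH) (fact ge lean limit.prems)+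
  \<comment> \<open>The smaller index has coefficients at most \<open>c + x + 1\<close>, hence at
    most \<open>\<phi> x\<close>: this is what the lower bound on \<open>\<phi>\<close> is
    for.\<close>
  also have "\<dots> \<le> fast (\<beta> + \<gamma>) (\<phi> x)"
  proof (rule fast_index_mono)
    show "lean (\<phi> x) (\<beta> + fund \<gamma> x)"
      by (rule lean_mono[OF lean_add[OF \<beta> lean]]) (use \<phi>[of x] in simp)
  qed (simp add: less_imp_le eps0_add_strict_mono fund_less limit.hyps)
  finally show ?case by (simp add: rel_fast_limit limit.hyps)
qed

text \<open>Ranging over all \<open>y\<close> past the linear bound builds in the monotonicity of
  \<open>g\<close>, which \<open>fast_mono\<close> grants only beyond the coefficients of the
  index.\<close>

definition lin_dominated :: "(nat \<Rightarrow> nat) \<Rightarrow> (nat \<Rightarrow> nat) \<Rightarrow> bool" where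
  "lin_dominated f g \<longleftrightarrow> (\<exists>A. \<forall>x y. A * x + A \<le> y \<longrightarrow> f x \<le> g y)"

text \<open>For the finitely many \<open>x\<close> below \<open>n + m\<close>, \<open>f x\<close> is
  at most the sum \<open>M\<close>, and \<open>M \<le> y \<le> fast \<gamma> y\<close>; for the
  others, \<open>\<phi> x\<close> is beyond the coefficients of the index.\<close>

lemma lin_dominated_fastI:
  assumes "\<And>x. n \<le> x \<Longrightarrow> f x \<le> fast \<gamma> (\<phi> x)" "\<And>x. x \<le> \<phi> x" "\<And>x. \<phi> x \<le> A * x + A"
  shows "lin_dominated f (fast \<gamma>)"
proof -
  obtain m where m: "lean m \<gamma>" using ex_lean by blast
  define M where "M = sum f {..<n + m}"
  have "f x \<le> fast \<gamma> y" if y: "(A + M) * x + (A + M) \<le> y" for x y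
  proof (cases "x < n + m")
    case True
    then have "f x \<le> M" unfolding M_def by (intro member_le_sum) auto
    also have "\<dots> \<le> y" using y by (simp add: algebra_simps)
    also have "\<dots> \<le> fast \<gamma> y" by (rule fast_ge)
    finally show ?thesis .
  next
    case False
    then have "f x \<le> fast \<gamma> (\<phi> x)" using assms(1) by simp
    also have "\<dots> \<le> fast \<gamma> y"
    proof (rule fast_mono)
      show "lean (\<phi> x + 1) \<gamma>"
        by (rule lean_mono[OF m]) (use False assms(2)[of x] in simp)
      show "\<phi> x \<le> y" using y assms(3)[of x] by (simp add: algebra_simps)
    qed
    finally show ?thesis .
  qed
  then show ?thesis unfolding lin_dominated_def by blast
qed

lemma lin_dominated_rel_fast:
  assumes "\<And>x. x \<le> h x" "lean c \<beta>" "\<And>x. x + c + 1 \<le> \<phi> x" "\<And>x. \<phi> x \<le> A * x + A"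
    and "\<alpha>\<^sub>0 \<le> 1" "\<And>x. n \<le> x \<Longrightarrow> \<phi> (rel_fast h \<alpha>\<^sub>0 x) \<le> fast (\<beta> + \<alpha>\<^sub>0) (\<phi> x)" "\<alpha>\<^sub>0 \<le> \<alpha>"
  shows "lin_dominated (rel_fast h \<alpha>) (fast (\<beta> + \<alpha>))"
proof -
  have \<phi>: "x \<le> \<phi> x" for x using assms(3)[of x] by simp
  obtain m where m: "lean m \<alpha>" using ex_lean by blast
  show ?thesis
  proof (rule lin_dominated_fastI[where n = "n + m" and \<phi> = \<phi> and A = A])
    fix x assume x: "n + m \<le> x"
    have "rel_fast h \<alpha> x \<le> \<phi> (rel_fast h \<alpha> x)" by (rule \<phi>)
    also have "\<dots> \<le> fast (\<beta> + \<alpha>) (\<phi> x)"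
      by (rule rel_fast_le_fast_add[where \<alpha>\<^sub>0 = \<alpha>\<^sub>0 and n = n])
        (use assms x in \<open>auto intro: lean_mono[OF m]\<close>)
    finally show "rel_fast h \<alpha> x \<le> fast (\<beta> + \<alpha>) (\<phi> x)" .
  qed (use \<phi> assms in auto)
qed

text \<open>At index 0 the shift by \<open>c + 1\<close> commutes as required by
  \<open>fast_add_le\<close>, since \<open>c\<close> bounds the coefficients of
  \<open>\<beta>\<close>.\<close>

lemma lin_dominated_rel_fast_pointwise:
  assumes "strict_mono h" "\<And>x. h x \<le> fast \<beta> x"
  shows "lin_dominated (rel_fast h \<alpha>) (fast (\<beta> + \<alpha>))"
proof -
  obtain c where c: "lean c \<beta>" using ex_lean by blast
  show ?thesis
  proof (rule lin_dominated_rel_fast[where \<phi> = "\<lambda>x. x + c + 1" and A = "c + 1" and \<alpha>\<^sub>0 = 0 and n = c])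
    fix x assume "c \<le> x"
    then have "lean (x + 1) \<beta>" by (intro lean_mono[OF c]) simp
    then have "fast \<beta> x + (c + 1) \<le> fast \<beta> (x + (c + 1))" by (rule fast_add_le)
    then show "rel_fast h 0 x + c + 1 \<le> fast (\<beta> + 0) (x + c + 1)"
      using assms(2)[of x] by (simp add: rel_fast_zero)
  qed (use assms c in \<open>auto intro: strict_mono_imp_increasing\<close>)
qed

lemma lin_dominated_fast_add: "lin_dominated (fast \<alpha>) (fast (\<beta> + \<alpha>))"
proof -
  have "lin_dominated (rel_fast (\<lambda>x. x + 1) \<alpha>) (fast (\<beta> + \<alpha>))"
    by (rule lin_dominated_rel_fast_pointwise) (simp_all add: strict_mono_def Suc_le_eq fast_gt)
  then show ?thesis by (simp only: fast_def)
qed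


section \<open>Majorants for the Grzegorczyk classes\<close>

text \<open>Two such families occur: the monotone members of a Grzegorczyk class, and the monotone
  functions below iterates of a fixed function.\<close>

definition majorizing :: "(nat \<Rightarrow> nat) set \<Rightarrow> bool" where
  "majorizing C \<longleftrightarrow> (\<forall>q \<in> C. mono q) \<and> (\<lambda>x. 0) \<in> C \<and> (\<lambda>x. x) \<in> C \<and>
    (\<forall>p \<in> C. \<forall>q \<in> C. (\<lambda>x. p x + q x) \<in> C \<and> (\<lambda>x. p (q x)) \<in> C)"

text \<open>The sum of the arguments measures their size. In \<open>comp\<close> the inner bounds
  add up and enter a monotone outer bound; in \<open>limrec\<close> the bound comes from
  \<open>b\<close>, as a maximum is at most the sum.\<close>

lemma grz_majorant:
  assumes "grz \<alpha> k f" and C: "majorizing C" and g: "g \<in> C" "\<And>x. fast \<alpha> x \<le> g x"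
  shows "\<exists>q \<in> C. \<forall>xs. length xs = k \<longrightarrow> f xs \<le> q (sum_list xs)"
  using assms(1)
proof induction
  case (zero k)
  show ?case by (rule bexI[of _ "\<lambda>x. 0"]) (use C in \<open>simp_all add: majorizing_def\<close>)
next
  case add
  have "xs ! 0 + xs ! 1 \<le> sum_list xs" if "length xs = 2" for xs :: "nat list"
    using that by (auto simp: numeral_2_eq_2 length_Suc_conv)
  then show ?case by (intro bexI[of _ "\<lambda>x. x"]) (use C in \<open>simp_all add: majorizing_def\<close>)
next
  case (proj i k)
  then show ?case by (intro bexI[of _ "\<lambda>x. x"])
    (use C in \<open>simp_all add: majorizing_def elem_le_sum_list\<close>)
next
  case fast
  show ?case by (rule bexI[OF _ g(1)]) (auto simp: length_Suc_conv g(2))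
next
  case (comp gs f k)
  from comp.IH(1) obtain q where q: "q \<in> C" "\<And>xs. length xs = length gs \<Longrightarrow> f xs \<le> q (sum_list xs)"
    by blast
  have "\<exists>r \<in> C. \<forall>xs. length xs = k \<longrightarrow> sum_list (map (\<lambda>g. g xs) hs) \<le> r (sum_list xs)"
    if "set hs \<subseteq> set gs" for hs
    using that
  proof (induction hs)
    case Nil
    show ?case by (rule bexI[of _ "\<lambda>x. 0"]) (use C in \<open>simp_all add: majorizing_def\<close>)
  next
    case (Cons g hs)
    then obtain r where r: "r \<in> C" "\<And>xs. length xs = k \<Longrightarrow> sum_list (map (\<lambda>g. g xs) hs) \<le> r (sum_list xs)"
      by auto
    obtain p where p: "p \<in> C" "\<And>xs. length xs = k \<Longrightarrow> g xs \<le> p (sum_list xs)"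
      using comp.IH(2) Cons.prems by auto
    show ?case
    proof (rule bexI)
      show "(\<lambda>x. p x + r x) \<in> C" using C p(1) r(1) by (simp add: majorizing_def)
      show "\<forall>xs. length xs = k \<longrightarrow>
          sum_list (map (\<lambda>g. g xs) (g # hs)) \<le> p (sum_list xs) + r (sum_list xs)"
        by (simp add: add_mono p(2) r(2))
    qed
  qed
  from this[OF order_refl] obtain r where r: "r \<in> C"
    "\<And>xs. length xs = k \<Longrightarrow> sum_list (map (\<lambda>g. g xs) gs) \<le> r (sum_list xs)" by blast
  have q_mono: "mono q" using C q(1) by (simp add: majorizing_def)
  have "f (map (\<lambda>g. g xs) gs) \<le> q (r (sum_list xs))" if "length xs = k" for xs
    using q(2)[of "map (\<lambda>g. g xs) gs"] monoD[OF q_mono r(2)[OF that]] by simp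
  moreover have "(\<lambda>x. q (r x)) \<in> C" using C q(1) r(1) by (simp add: majorizing_def)
  ultimately show ?case by (intro bexI[of _ "\<lambda>x. q (r x)"]) simp_all
next
  case (limrec k f\<^sub>0 f\<^sub>1 b f)
  from limrec.IH(3) obtain q where q: "q \<in> C" "\<And>xs. length xs = 1 \<Longrightarrow> b xs \<le> q (sum_list xs)"
    by blast
  have "f zs \<le> q (sum_list zs)" if len: "length zs = k + 1" for zs
  proof -
    obtain y xs where zs: "zs = y # xs" "length xs = k"
      using len by (cases zs) auto
    have "f zs \<le> b [Max (set zs)]" using limrec.hyps zs by simp
    also have "\<dots> \<le> q (Max (set zs))" using q(2)[of "[Max (set zs)]"] by simp
    also have "\<dots> \<le> q (sum_list zs)"
    proof (rule monoD[where f = q])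
      show "mono q" using C q(1) by (simp add: majorizing_def)
      have "Max (set zs) \<in> set zs" using zs by (intro Max_in) auto
      then show "Max (set zs) \<le> sum_list zs" by (intro member_le_sum_list) simp_all
    qed
    finally show ?thesis .
  qed
  then show ?case using q(1) by blast
next
  case (ext k f g)
  then show ?case by auto
qed

corollary Grz1_majorant:
  assumes "p \<in> Grz1 \<alpha>" "majorizing C" "g \<in> C" "\<And>x. fast \<alpha> x \<le> g x"
  shows "\<exists>q \<in> C. \<forall>x. p x \<le> q x"
proof -
  have "grz \<alpha> 1 (\<lambda>xs. p (xs ! 0))" using assms(1) by (simp add: Grz1_def)
  from grz_majorant[OF this assms(2-4)] obtain q where q: "q \<in> C"
    "\<And>xs. length xs = 1 \<Longrightarrow> p (xs ! 0) \<le> q (sum_list xs)" by blast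
  have "p x \<le> q x" for x using q(2)[of "[x]"] by simp
  then show ?thesis using q(1) by blast
qed

section \<open>Closure properties of the unary classes\<close>

lemma Grz1_zero: "(\<lambda>x. 0) \<in> Grz1 \<alpha>"
  by (simp add: Grz1_def grz.zero)

lemma Grz1_id: "(\<lambda>x. x) \<in> Grz1 \<alpha>"
  by (simp add: Grz1_def grz.proj)

lemma Grz1_fast: "fast \<alpha> \<in> Grz1 \<alpha>"
  using grz.fast by (simp add: Grz1_def)

lemma Grz1_add:
  assumes "p \<in> Grz1 \<alpha>" "q \<in> Grz1 \<alpha>"
  shows "(\<lambda>x. p x + q x) \<in> Grz1 \<alpha>"
proof -
  let ?gs = "[\<lambda>xs. p (xs ! 0), \<lambda>xs. q (xs ! 0)]"
  have "grz \<alpha> (length ?gs) (\<lambda>xs. xs ! 0 + xs ! 1)"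
    using grz.add[of \<alpha>] by (simp only: list.size numeral_2_eq_2 add_0 add_Suc_right One_nat_def add_0_right)
  moreover have "\<forall>g \<in> set ?gs. grz \<alpha> 1 g" using assms by (simp add: Grz1_def)
  ultimately have "grz \<alpha> 1 (\<lambda>xs. map (\<lambda>g. g xs) ?gs ! 0 + map (\<lambda>g. g xs) ?gs ! 1)"
    by (rule grz.comp)
  then show ?thesis by (simp add: Grz1_def)
qed

lemma Grz1_comp: "p \<in> Grz1 \<alpha> \<Longrightarrow> q \<in> Grz1 \<alpha> \<Longrightarrow> (\<lambda>x. p (q x)) \<in> Grz1 \<alpha>"
  using grz.comp[of \<alpha> "[\<lambda>xs. q (xs ! 0)]" "\<lambda>xs. p (xs ! 0)" 1]
  by (simp add: Grz1_def)

lemma Grz1_mult: "p \<in> Grz1 \<alpha> \<Longrightarrow> (\<lambda>x. n * p x) \<in> Grz1 \<alpha>"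
  by (induction n) (auto simp: Grz1_zero intro: Grz1_add)

text \<open>The successor is not a generator, so constants are obtained as multiples of \<open>fast \<alpha> 0\<close>.\<close>

lemma Grz1_linear:
  assumes "p \<in> Grz1 \<alpha>"
  shows "(\<lambda>x. n * p x + n * fast \<alpha> 0) \<in> Grz1 \<alpha>"
proof (rule Grz1_add)
  show "(\<lambda>x. n * p x) \<in> Grz1 \<alpha>" using assms by (rule Grz1_mult)
  show "(\<lambda>x. n * fast \<alpha> 0) \<in> Grz1 \<alpha>"
    using Grz1_comp[OF Grz1_fast Grz1_zero] by (rule Grz1_mult)
qed

text \<open>Takes the place of an inclusion of classes. By \<open>Grz1_majorant\<close> it suffices
  to bound \<open>fast \<alpha>\<close> by a monotone member of the larger-index class.\<close>

lemma Grz1_majorant_fast_add: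
  assumes "p \<in> Grz1 \<alpha>"
  shows "\<exists>q \<in> Grz1 (\<beta> + \<alpha>). \<forall>x. p x \<le> q x"
proof -
  define \<delta> where "\<delta> = \<beta> + \<alpha>"
  obtain A where A: "\<And>x y. A * x + A \<le> y \<Longrightarrow> fast \<alpha> x \<le> fast \<delta> y"
    using lin_dominated_fast_add[of \<alpha> \<beta>] by (auto simp: lin_dominated_def \<delta>_def)
  obtain n where n: "lean n \<delta>" using ex_lean by blast
  \<comment> \<open>\<open>A\<close> secures domination of \<open>fast \<alpha>\<close>,
    \<open>n\<close> passes the coefficients of \<open>\<delta>\<close>, and
    \<open>fast \<delta> 0\<close>, being at least 1, supplies the additive constant.\<close>
  define l where "l x = (A + n) * x + (A + n) * fast \<delta> 0" for x
  have pos: "1 \<le> fast \<delta> 0" using fast_gt[of 0 \<delta>] by simp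
  have l_ge: "(A + n) * x + (A + n) \<le> l x" for x
    using mult_le_mono2[OF pos, of "A + n"] by (simp add: l_def)
  have "mono (\<lambda>x. fast \<delta> (l x))"
  proof (rule monoI)
    fix x y :: nat assume "x \<le> y"
    show "fast \<delta> (l x) \<le> fast \<delta> (l y)"
    proof (rule fast_mono)
      show "lean (l x + 1) \<delta>" by (rule lean_mono[OF n]) (use l_ge[of x] in simp)
      show "l x \<le> l y" using \<open>x \<le> y\<close> by (simp add: l_def)
    qed
  qed
  moreover have "(\<lambda>x. fast \<delta> (l x)) \<in> Grz1 \<delta>"
    unfolding l_def by (rule Grz1_comp[OF Grz1_fast Grz1_linear[OF Grz1_id]])
  moreover have "fast \<alpha> x \<le> fast \<delta> (l x)" for x
    using l_ge[of x] by (intro A) (simp add: algebra_simps)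
  moreover have "majorizing {q. mono q \<and> q \<in> Grz1 \<delta>}"
    unfolding majorizing_def
  proof (intro conjI ballI; (elim CollectE conjE)?)
    fix p q assume "mono p" "p \<in> Grz1 \<delta>" "mono q" "q \<in> Grz1 \<delta>"
    then show "(\<lambda>x. p x + q x) \<in> {q. mono q \<and> q \<in> Grz1 \<delta>}"
      and "(\<lambda>x. p (q x)) \<in> {q. mono q \<and> q \<in> Grz1 \<delta>}"
      using Grz1_add[of p \<delta> q] Grz1_comp[of p \<delta> q] by (simp_all add: mono_def add_mono)
  qed (simp_all add: mono_def Grz1_zero Grz1_id)
  ultimately have "\<exists>q \<in> {q. mono q \<and> q \<in> Grz1 \<delta>}. \<forall>x. p x \<le> q x"
    by (intro Grz1_majorant[OF assms, where g = "\<lambda>x. fast \<delta> (l x)"]) simp_all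
  then show ?thesis unfolding \<delta>_def by blast
qed

text \<open>The monotone functions below iterates of \<open>F\<close> form a majorizing family:
  composition adds the exponents, and a sum costs one more application because \<open>F\<close> at
  least doubles.\<close>

lemma Grz1_le_funpow:
  assumes "p \<in> Grz1 \<alpha>" "mono F" "\<And>x. 2 * x + 1 \<le> F x" "\<And>x. fast \<alpha> x \<le> F x"
  shows "\<exists>m. \<forall>x. p x \<le> (F ^^ m) x"
proof -
  let ?C = "{q. mono q \<and> (\<exists>m. \<forall>x. q x \<le> (F ^^ m) x)}"
  have ge: "x \<le> F x" for x using assms(3)[of x] by simp
  have F: "F \<in> ?C" using assms(2) by (auto intro!: exI[of _ "1 :: nat"])
  have C: "majorizing ?C"
    unfolding majorizing_def
  proof (intro conjI ballI)
    fix q r assume "q \<in> ?C" "r \<in> ?C"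
    then obtain k l where q: "mono q" "\<And>x. q x \<le> (F ^^ k) x"
      and r: "mono r" "\<And>x. r x \<le> (F ^^ l) x" by blast
    have "q x + r x \<le> (F ^^ Suc (k + l)) x" for x
    proof -
      have "(F ^^ k) x \<le> (F ^^ (k + l)) x" "(F ^^ l) x \<le> (F ^^ (k + l)) x"
        by (intro funpow_increasing ge; simp)+
      then show ?thesis
        using q(2)[of x] r(2)[of x] assms(3)[of "(F ^^ (k + l)) x"] by simp
    qed
    moreover have "mono (\<lambda>x. q x + r x)" using q r by (auto simp: mono_def intro: add_mono)
    ultimately show "(\<lambda>x. q x + r x) \<in> ?C" by blast
    have "q (r x) \<le> (F ^^ (k + l)) x" for x
    proof -
      have "q (r x) \<le> (F ^^ k) (r x)" by (rule q)
      also have "\<dots> \<le> (F ^^ k) ((F ^^ l) x)"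
        by (rule funpow_le[of 0]) (use assms(2) r ge in \<open>auto simp: mono_def\<close>)
      finally show ?thesis by (simp add: funpow_add)
    qed
    moreover have "mono (\<lambda>x. q (r x))" using q r by (auto simp: mono_def)
    ultimately show "(\<lambda>x. q (r x)) \<in> ?C" by blast
  next
    show "(\<lambda>x. x) \<in> ?C" by (auto simp: mono_def intro!: exI[of _ "0 :: nat"])
    show "(\<lambda>x. 0) \<in> ?C" by (auto simp: mono_def)
  qed auto
  have "\<exists>q \<in> ?C. \<forall>x. p x \<le> q x"
    by (rule Grz1_majorant[OF assms(1) C F assms(4)])
  then obtain q m where q: "\<And>x. p x \<le> q x" "\<And>x. q x \<le> (F ^^ m) x" by blast
  have "p x \<le> (F ^^ m) x" for x using q[of x] by (rule order_trans)
  then show ?thesis by blast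
qed

text \<open>Since \<open>F\<close> at least doubles and the iterates stay above \<open>x\<close>,
  each application gains at least \<open>x + 1\<close>. Constant factors are thus absorbed by
  iteration.\<close>

lemma mult_le_funpow:
  assumes "\<And>x. 2 * x + 1 \<le> (F x :: nat)"
  shows "k * (x + 1) \<le> (F ^^ k) x"
proof (induction k)
  case (Suc k)
  have "y \<le> F y" for y using assms[of y] by simp
  then have "x \<le> (F ^^ k) x" by (rule le_funpow)
  then have "Suc k * (x + 1) \<le> 2 * (F ^^ k) x + 1" using Suc unfolding mult_Suc by linarith
  also have "\<dots> \<le> F ((F ^^ k) x)" by (rule assms)
  finally show ?case by simp
qed simp

text \<open>Monotonicity of \<open>?F\<close> is available only beyond the coefficients of its
  index, so \<open>Grz1_le_funpow\<close> is applied to the globally monotone \<open>G\<close>,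
  whose iterates are then unfolded.\<close>

lemma Grz1_le_fast_funpow:
  assumes "p \<in> Grz1 \<beta>"
  shows "\<exists>k n. \<forall>x \<ge> n. p x \<le> (fast (\<beta> + 1) ^^ k) x"
proof -
  let ?F = "fast (\<beta> + 1)"
  have "lin_dominated (fast \<beta>) ?F"
  proof (rule lin_dominated_fastI[where \<phi> = "\<lambda>x. x" and A = 1])
    show "fast \<beta> x \<le> ?F x" for x
      unfolding fast_succ using fast_ge by (rule le_funpow_Suc)
  qed auto
  then obtain A where A: "\<And>x y. A * x + A \<le> y \<Longrightarrow> fast \<beta> x \<le> ?F y"
    by (auto simp: lin_dominated_def)
  obtain n where n: "lean n (\<beta> + 1)" using ex_lean by blast
  define B where "B = A + n + 1"
  define G where "G x = ?F (B * (x + 1))" for x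
  have lean: "lean (y + 1) (\<beta> + 1)" if "n \<le> y" for y
    by (rule lean_mono[OF n]) (use that in simp)
  have B: "x + n \<le> B * (x + 1)" for x by (simp add: B_def algebra_simps)
  have "mono G"
  proof (rule monoI)
    fix x y :: nat assume "x \<le> y"
    then show "G x \<le> G y" unfolding G_def using B[of x]
      by (intro fast_mono lean mult_le_mono2) simp_all
  qed
  moreover have "2 * x + 1 \<le> G x" for x
    using fast_succ_ge[of "B * (x + 1)" \<beta>] B[of x] by (simp add: G_def)
  moreover have "fast \<beta> x \<le> G x" for x
    unfolding G_def by (rule A) (simp add: B_def algebra_simps)
  moreover from fast_ge this have ge: "x \<le> G x" for x by (rule order_trans)
  ultimately obtain m where m: "\<And>x. p x \<le> (G ^^ m) x"
    using Grz1_le_funpow[OF assms, of G] by blast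
  \<comment> \<open>The inner factor of \<open>G\<close> is absorbed by \<open>B\<close>
    applications of \<open>?F\<close>, so each \<open>G\<close> costs \<open>B + 1\<close> of
    them.\<close>
  have "(G ^^ i) x \<le> (?F ^^ ((B + 1) * i)) x" if "n \<le> x" for i x
  proof -
    have "(G ^^ i) x \<le> ((?F ^^ (B + 1)) ^^ i) x"
    proof (rule funpow_le[where n = n])
      fix u v assume uv: "n \<le> u" "u \<le> v"
      have "B * (u + 1) \<le> B * (v + 1)" using uv by (intro mult_le_mono2) simp
      also have "\<dots> \<le> (?F ^^ B) v" by (rule mult_le_funpow) (rule fast_succ_ge)
      finally show "G u \<le> (?F ^^ (B + 1)) v"
        unfolding G_def using B[of u] uv by (simp del: mult_Suc_right) (intro fast_mono lean; simp)
    qed (use that ge in auto)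
    then show ?thesis by (simp only: funpow_mult mult.commute)
  qed
  then have "p x \<le> (?F ^^ ((B + 1) * m)) x" if "n \<le> x" for x
    using order_trans[OF m] that by blast
  then show ?thesis by blast
qed

text \<open>The comparison starts at index 1: one value of \<open>h\<close> may cost
  \<open>k\<close> applications of \<open>?F\<close>, more than index 0 offers, while the
  \<open>x + 1\<close> values of \<open>h\<close> at index 1 cost \<open>k * (x + 1)\<close>, which
  fits.\<close>

lemma lin_dominated_rel_fast_Grz1:
  assumes "strict_mono h" "h \<in> Grz1 \<beta>" "1 \<le> \<alpha>"
  shows "lin_dominated (rel_fast h \<alpha>) (fast (\<beta> + 1 + \<alpha>))"
proof -
  let ?F = "fast (\<beta> + 1)"
  have h: "x \<le> h x" for x using assms(1) by (rule strict_mono_imp_increasing)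
  obtain k\<^sub>0 m where k\<^sub>0: "\<And>x. m \<le> x \<Longrightarrow> h x \<le> (?F ^^ k\<^sub>0) x"
    using Grz1_le_fast_funpow[OF assms(2)] by blast
  obtain n where n: "lean n (\<beta> + 1)" using ex_lean by blast
  \<comment> \<open>From \<open>k \<ge> 2\<close> and \<open>c \<ge> 3\<close> follows
    \<open>2 * k + c \<le> k * c + 1\<close>, so that \<open>k + c + k * (x + 1)\<close>
    applications fit into the \<open>k * (x + c) + 1\<close> available ones.\<close>
  define k c where "k = k\<^sub>0 + 2" and "c = n + 3"
  have lean: "lean (y + 1) (\<beta> + 1)" if "n \<le> y" for y
    by (rule lean_mono[OF n]) (use that in simp)
  have F_mono: "(?F ^^ i) u \<le> (?F ^^ i) v" if "n \<le> u" "u \<le> v" for i u v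
    using that by (intro funpow_le[of n]) (auto intro: fast_mono lean fast_ge)
  have h_le: "h u \<le> (?F ^^ k) v" if "m + n \<le> u" "u \<le> v" for u v
  proof -
    have "h u \<le> (?F ^^ k\<^sub>0) u" using k\<^sub>0 that by simp
    also have "\<dots> \<le> (?F ^^ k) u" by (intro funpow_increasing fast_ge) (simp add: k_def)
    also have "\<dots> \<le> (?F ^^ k) v" using that by (intro F_mono) auto
    finally show ?thesis .
  qed
  show ?thesis
  proof (rule lin_dominated_rel_fast[where \<phi> = "\<lambda>x. k * (x + c)" and c = n and A = "k * c"
        and \<alpha>\<^sub>0 = 1 and n = "m + n"])
    fix x assume x: "m + n \<le> x"
    define z where "z = (?F ^^ (k * (x + 1))) x"
    have "rel_fast h (0 + 1) x = (h ^^ (x + 1)) x"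
      unfolding rel_fast_succ by (simp add: rel_fast_zero[abs_def])
    also have "\<dots> \<le> ((?F ^^ k) ^^ (x + 1)) x"
      by (rule funpow_le[where n = "m + n"]) (use h_le h x in auto)
    also have "\<dots> = z" by (simp only: z_def funpow_mult mult.commute)
    finally have "k * (rel_fast h 1 x + c) \<le> k * (z + c)" by simp
    \<comment> \<open>The outer \<open>+ c\<close> and the factor \<open>k\<close> are absorbed by
      \<open>c\<close> and \<open>k\<close> further applications.\<close>
    also have "\<dots> \<le> k * ((?F ^^ c) z + 1)"
      using add_le_funpow[of ?F z c] fast_gt by (intro mult_le_mono2) (simp add: le_SucI)
    also have "\<dots> \<le> (?F ^^ k) ((?F ^^ c) z)" by (rule mult_le_funpow) (rule fast_succ_ge)
    also have "\<dots> = (?F ^^ (k + c + k * (x + 1))) x" by (simp add: z_def funpow_add)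
    also have "\<dots> \<le> (?F ^^ (k + c + k * (x + 1))) (k * (x + c))"
      using x by (intro F_mono) (auto simp: k_def)
    also have "\<dots> \<le> (?F ^^ (k * (x + c) + 1)) (k * (x + c))"
      by (intro funpow_increasing fast_ge) (simp add: k_def c_def algebra_simps)
    also have "\<dots> = fast (\<beta> + 1 + 1) (k * (x + c))" by (simp only: fast_succ)
    finally show "k * (rel_fast h 1 x + c) \<le> fast (\<beta> + 1 + 1) (k * (x + c))" .
  next
    show "x + n + 1 \<le> k * (x + c)" for x by (simp add: k_def c_def)
    show "k * (x + c) \<le> k * c * x + k * c" for x by (simp add: c_def algebra_simps)
  qed (use h n assms in auto)
qed


section \<open>The complexity classes\<close>

lemma DTime_mono:
  assumes "\<And>n. s n \<le> t n"
  shows "DTime s \<subseteq> DTime t"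
  unfolding DTime_def decides_in_time_def using assms by (blast intro: order_trans)

text \<open>The linear change of argument moves into the inner function: \<open>q\<close> stays in
  \<open>Grz1 (\<beta> + \<gamma>)\<close>, and addition is strictly increasing on the
  right.\<close>

lemma rel_FC_subset_FC:
  assumes "lin_dominated (rel_fast h \<alpha>) (fast (\<beta> + \<alpha>))"
  shows "(rel_FC h \<alpha> :: 'a::finite list set set) \<subseteq> FC (\<beta> + \<alpha>)"
proof -
  obtain A where A: "\<And>x y. A * x + A \<le> y \<Longrightarrow> rel_fast h \<alpha> x \<le> fast (\<beta> + \<alpha>) y"
    using assms by (auto simp: lin_dominated_def)
  have "\<exists>q \<in> Grz1_below (\<beta> + \<alpha>). (DTime (\<lambda>n. rel_fast h \<alpha> (p n)) :: 'a list set set)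
      \<subseteq> DTime (\<lambda>n. fast (\<beta> + \<alpha>) (q n))" if "p \<in> Grz1_below \<alpha>" for p
  proof -
    obtain \<gamma> where \<gamma>: "\<gamma> < \<alpha>" "p \<in> Grz1 \<gamma>" using \<open>p \<in> _\<close> by (auto simp: Grz1_below_def)
    obtain r where r: "r \<in> Grz1 (\<beta> + \<gamma>)" "\<And>x. p x \<le> r x"
      using Grz1_majorant_fast_add[OF \<gamma>(2)] by blast
    define q where "q n = A * r n + A * fast (\<beta> + \<gamma>) 0" for n
    have "A * 1 \<le> A * fast (\<beta> + \<gamma>) 0"
      using fast_gt[of 0 "\<beta> + \<gamma>"] by (intro mult_le_mono2) simp
    then have "A * p n + A \<le> q n" for n
      unfolding q_def by (intro add_mono mult_le_mono2 r(2)) simp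
    then have "(DTime (\<lambda>n. rel_fast h \<alpha> (p n)) :: 'a list set set)
        \<subseteq> DTime (\<lambda>n. fast (\<beta> + \<alpha>) (q n))"
      by (intro DTime_mono A)
    moreover have "q \<in> Grz1_below (\<beta> + \<alpha>)"
      using Grz1_linear[OF r(1), of A] eps0_add_strict_mono[OF \<gamma>(1), of \<beta>]
      by (auto simp: Grz1_below_def q_def[abs_def])
    ultimately show ?thesis by blast
  qed
  then show ?thesis unfolding rel_FC_def FC_def by blast
qed

theorem theorem4p2:
  fixes h :: "nat \<Rightarrow> nat" and \<alpha> \<beta> :: eps0
  assumes "strict_mono h"
  shows "(h \<in> Grz1 \<beta> \<longrightarrow>
            (rel_FC h \<alpha> :: 'a::finite list set set) \<subseteq> FC (\<beta> + 1 + \<alpha>)) \<and>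
         ((\<forall>x. h x \<le> fast \<beta> x) \<longrightarrow>
            (rel_FC h \<alpha> :: 'a list set set) \<subseteq> FC (\<beta> + \<alpha>))"
proof (intro conjI impI)
  assume h: "h \<in> Grz1 \<beta>"
  show "(rel_FC h \<alpha> :: 'a list set set) \<subseteq> FC (\<beta> + 1 + \<alpha>)"
  proof (cases "\<alpha> = 0")
    case True
    \<comment> \<open>No index lies below 0, so the left-hand class is an empty union.\<close>
    then show ?thesis by (auto simp: rel_FC_def Grz1_below_def)
  next
    case False
    then have "1 \<le> \<alpha>" using succ_le_iff[of 0 \<alpha>] by (simp add: order.strict_iff_order)
    then show ?thesis by (intro rel_FC_subset_FC lin_dominated_rel_fast_Grz1 assms h)
  qed
next
  assume "\<forall>x. h x \<le> fast \<beta> x"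
  then show "(rel_FC h \<alpha> :: 'a list set set) \<subseteq> FC (\<beta> + \<alpha>)"
    by (intro rel_FC_subset_FC lin_dominated_rel_fast_pointwise assms) simp
qed

end
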